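(* Let $n\le m$ be positive integers and let $(\mathfrak g,\mathfrak g_0)=(\mathfrak{gl}_{n+m},\mathfrak{gl}_n\oplus\mathfrak{gl}_m)$ with symmetric decomposition $\mathfrak g=\mathfrak g_0\oplus\mathfrak g_1$. Then the commuting variety $\mathfrak C(\mathfrak g_1)=\{(x,y)\in\mathfrak g_1\times\mathfrak g_1\mid [x,y]=0\}$ has at least $2\min(2n,m)-2n+1$ irreducible components.
   Context: The ground field $\Bbbk$ is algebraically closed of characteristic zero. In the symmetric pair $(\mathfrak{gl}_{n+m},\mathfrak{gl}_n\oplus\mathfrak{gl}_m)$, $\sigma$ is conjugation by the diagonal matrix with $n$ entries $-1$ followed by $m$ entries $1$; $\mathfrak g_0$ (the fixed points of $\sigma$) is the subalgebra of block-diagonal matrices with blocks of sizes $n$ and $m$, and $\mathfrak g_1$ (the $(-1)$-eigenspace of $\sigma$) consists of the matrices $\begin{pmatrix} 0 & Y \\ X & 0 \end{pmatrix}$ with $X$ an arbitrary $m\times n$ matrix and $Y$ an arbitrary $n\times m$ matrix. Irreducible components are taken in the Zariski topology. *)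

theory Defs
  imports
    "HOL-Analysis.Abstract_Topology"
    "HOL-Computational_Algebra.Polynomial"
    "Jordan_Normal_Form.Matrix"
begin

definition irreducible_in :: "'b topology \<Rightarrow> 'b set \<Rightarrow> bool" where
  "irreducible_in X S \<longleftrightarrow> S \<subseteq> topspace X \<and> S \<noteq> {} \<and>
     (\<forall>A B. closedin X A \<longrightarrow> closedin X B \<longrightarrow> S \<subseteq> A \<union> B \<longrightarrow> S \<subseteq> A \<or> S \<subseteq> B)"

text \<open>Maximal irreducible subsets; these are automatically closed.\<close>

definition irreducible_components :: "'b topology \<Rightarrow> 'b set set" where
  "irreducible_components X =
     {S. irreducible_in X S \<and> (\<forall>T. irreducible_in X T \<longrightarrow> S \<subseteq> T \<longrightarrow> T = S)}"

text \<open>Polynomial functions in a given set of coordinate functions: the subalgebra of all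
  functions into the ground field generated by the coordinates.\<close>

inductive_set poly_functions :: "('b \<Rightarrow> 'a::comm_ring_1) set \<Rightarrow> ('b \<Rightarrow> 'a) set"
  for coords :: "('b \<Rightarrow> 'a) set" where
  const: "(\<lambda>_. c) \<in> poly_functions coords"
| coord: "f \<in> coords \<Longrightarrow> f \<in> poly_functions coords"
| add: "f \<in> poly_functions coords \<Longrightarrow> g \<in> poly_functions coords \<Longrightarrow>
    (\<lambda>v. f v + g v) \<in> poly_functions coords"
| mult: "f \<in> poly_functions coords \<Longrightarrow> g \<in> poly_functions coords \<Longrightarrow>
    (\<lambda>v. f v * g v) \<in> poly_functions coords"

definition zero_locus :: "'b set \<Rightarrow> ('b \<Rightarrow> 'a::zero) set \<Rightarrow> 'b set" where
  "zero_locus V F = {v \<in> V. \<forall>f\<in>F. f v = 0}"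

definition zariski_topology :: "'b set \<Rightarrow> ('b \<Rightarrow> 'a::idom) set \<Rightarrow> 'b topology" where
  "zariski_topology V coords =
     topology (\<lambda>U. \<exists>F \<subseteq> poly_functions coords. U = V - zero_locus V F)"

lemma istopology_zariski:
  fixes coords :: "('b \<Rightarrow> 'a::idom) set"
  shows "istopology (\<lambda>U. \<exists>F \<subseteq> poly_functions coords. U = V - zero_locus V F)"
  unfolding istopology_def
proof (intro conjI allI impI)
  fix S T
  assume "\<exists>F \<subseteq> poly_functions coords. S = V - zero_locus V F"
    and "\<exists>F \<subseteq> poly_functions coords. T = V - zero_locus V F"
  then obtain F G where F: "F \<subseteq> poly_functions coords" "S = V - zero_locus V F"
    and G: "G \<subseteq> poly_functions coords" "T = V - zero_locus V G"
    by blast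
  let ?H = "{\<lambda>v. f v * g v | f g. f \<in> F \<and> g \<in> G}"
  have "?H \<subseteq> poly_functions coords"
    using F(1) G(1) by (auto intro: poly_functions.mult)
  moreover have "S \<inter> T = V - zero_locus V ?H"
    unfolding F(2) G(2) zero_locus_def by fastforce
  ultimately show "\<exists>F \<subseteq> poly_functions coords. S \<inter> T = V - zero_locus V F"
    by blast
next
  fix K :: "'b set set"
  assume "\<forall>U\<in>K. \<exists>F \<subseteq> poly_functions coords. U = V - zero_locus V F"
  then obtain F where F: "\<And>U. U \<in> K \<Longrightarrow> F U \<subseteq> poly_functions coords"
      "\<And>U. U \<in> K \<Longrightarrow> U = V - zero_locus V (F U)"
    by metis
  have "\<Union>K = (\<Union>U\<in>K. V - zero_locus V (F U))"
    using F(2) by auto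
  also have "\<dots> = V - zero_locus V (\<Union>U\<in>K. F U)"
    unfolding zero_locus_def by auto
  finally show "\<exists>G \<subseteq> poly_functions coords. \<Union>K = V - zero_locus V G"
    using F(1) by (intro exI[of _ "\<Union>U\<in>K. F U"]) blast
qed

lemma openin_zariski:
  "openin (zariski_topology V coords) U \<longleftrightarrow>
     (\<exists>F \<subseteq> poly_functions coords. U = V - zero_locus V F)"
  unfolding zariski_topology_def by (simp add: topology_inverse'[OF istopology_zariski])

lemma topspace_zariski [simp]: "topspace (zariski_topology V coords) = V"
proof
  show "topspace (zariski_topology V coords) \<subseteq> V"
    unfolding topspace_def by (auto simp: openin_zariski)
  have "openin (zariski_topology V coords) V"
    unfolding openin_zariski
    by (rule exI[of _ "{\<lambda>_. 1}"]) (auto simp: zero_locus_def intro: poly_functions.const)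
  then show "V \<subseteq> topspace (zariski_topology V coords)"
    by (rule openin_subset)
qed

lemma closedin_zariski:
  "closedin (zariski_topology V coords) Z \<longleftrightarrow>
     (\<exists>F \<subseteq> poly_functions coords. Z = zero_locus V F)"
proof -
  have "zero_locus V F \<subseteq> V" for F :: "('a \<Rightarrow> 'b) set"
    by (auto simp: zero_locus_def)
  then show ?thesis
    unfolding closedin_def topspace_zariski openin_zariski by (metis Diff_Diff_Int inf.absorb_iff2)
qed

text \<open>The affine space of pairs of \<open>N \<times> N\<close> matrices, with the matrix entries as coordinates.\<close>

definition pair_entries :: "nat \<Rightarrow> ('a mat \<times> 'a mat \<Rightarrow> 'a) set" where
  "pair_entries N = {\<lambda>(x, y). x $$ (i, j) | i j. i < N \<and> j < N}
                  \<union> {\<lambda>(x, y). y $$ (i, j) | i j. i < N \<and> j < N}"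

definition zariski_mat_pairs :: "nat \<Rightarrow> ('a::idom mat \<times> 'a mat) topology" where
  "zariski_mat_pairs N = zariski_topology (carrier_mat N N \<times> carrier_mat N N) (pair_entries N)"

definition sign_mat :: "nat \<Rightarrow> nat \<Rightarrow> 'a::comm_ring_1 mat" where
  "sign_mat n m = mat_diag (n + m) (\<lambda>i. if i < n then - 1 else 1)"

lemma sign_mat_carrier [simp]: "sign_mat n m \<in> carrier_mat (n + m) (n + m)"
  by (simp add: sign_mat_def)

lemma sign_mat_involutive: "sign_mat n m * sign_mat n m = 1\<^sub>m (n + m)"
  unfolding sign_mat_def mat_diag_diag
  by (rule eq_matI) (auto simp: mat_diag_def)

text \<open>Conjugation by the diagonal sign matrix, which is its own inverse; \<open>g0 n m\<close> and
  \<open>g1 n m\<close> are the eigenspaces for \<open>1\<close> and \<open>- 1\<close> in \<open>gl(n + m)\<close>.\<close>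

definition sigma :: "nat \<Rightarrow> nat \<Rightarrow> 'a::comm_ring_1 mat \<Rightarrow> 'a mat" where
  "sigma n m x = sign_mat n m * x * sign_mat n m"

definition g0 :: "nat \<Rightarrow> nat \<Rightarrow> 'a::comm_ring_1 mat set" where
  "g0 n m = {x \<in> carrier_mat (n + m) (n + m). sigma n m x = x}"

definition g1 :: "nat \<Rightarrow> nat \<Rightarrow> 'a::comm_ring_1 mat set" where
  "g1 n m = {x \<in> carrier_mat (n + m) (n + m). sigma n m x = - x}"

lemma sigma_index:
  assumes "x \<in> carrier_mat (n + m) (n + m)" "i < n + m" "j < n + m"
  shows "sigma n m x $$ (i, j) = (if (i < n) = (j < n) then x $$ (i, j) else - x $$ (i, j))"
proof -
  have "sign_mat n m * x \<in> carrier_mat (n + m) (n + m)"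
    using assms(1) by (meson mult_carrier_mat sign_mat_carrier)
  then show ?thesis
    using assms
    by (simp add: sigma_def sign_mat_def mat_diag_mult_left[of _ "n + m" "n + m"]
        mat_diag_mult_right[of _ "n + m" "n + m"])
qed

lemma sigma_carrier:
  "x \<in> carrier_mat (n + m) (n + m) \<Longrightarrow> sigma n m x \<in> carrier_mat (n + m) (n + m)"
  unfolding sigma_def by (meson mult_carrier_mat sign_mat_carrier)

lemma g0_block:
  fixes x :: "'a::{idom, ring_char_0} mat"
  shows "x \<in> g0 n m \<longleftrightarrow>
    (\<exists>A \<in> carrier_mat n n. \<exists>B \<in> carrier_mat m m.
       x = four_block_mat A (0\<^sub>m n m) (0\<^sub>m m n) B)"
proof
  assume x: "x \<in> g0 n m"
  then have c: "x \<in> carrier_mat (n + m) (n + m)" and s: "sigma n m x = x"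
    by (auto simp: g0_def)
  have z: "x $$ (i, j) = 0" if "i < n + m" "j < n + m" "(i < n) \<noteq> (j < n)" for i j
    using sigma_index[OF c that(1,2)] that s by auto
  let ?A = "mat n n (\<lambda>(i, j). x $$ (i, j))" and ?B = "mat m m (\<lambda>(i, j). x $$ (i + n, j + n))"
  have "x = four_block_mat ?A (0\<^sub>m n m) (0\<^sub>m m n) ?B"
    by (rule eq_matI) (use c z in \<open>auto simp: four_block_mat_def Let_def\<close>)
  then show "\<exists>A \<in> carrier_mat n n. \<exists>B \<in> carrier_mat m m.
       x = four_block_mat A (0\<^sub>m n m) (0\<^sub>m m n) B"
    by (meson mat_carrier)
next
  assume "\<exists>A \<in> carrier_mat n n. \<exists>B \<in> carrier_mat m m.
       x = four_block_mat A (0\<^sub>m n m) (0\<^sub>m m n) B"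
  then obtain A B where AB: "A \<in> carrier_mat n n" "B \<in> carrier_mat m m"
    and x: "x = four_block_mat A (0\<^sub>m n m) (0\<^sub>m m n) B" by blast
  have c: "x \<in> carrier_mat (n + m) (n + m)"
    unfolding x using AB by simp
  have "sigma n m x = x"
  proof (rule eq_matI)
    fix i j
    assume "i < dim_row (x)" "j < dim_col (x)"
    then have ij: "i < n + m" "j < n + m" using c by auto
    show "sigma n m x $$ (i, j) = (x) $$ (i, j)"
      unfolding sigma_index[OF c ij] using c ij AB by (auto simp: x)
  qed (use c sigma_carrier[OF c] in auto)
  then show "x \<in> g0 n m" using c by (simp add: g0_def)
qed

lemma g1_block:
  fixes x :: "'a::{idom, ring_char_0} mat"
  shows "x \<in> g1 n m \<longleftrightarrow>
    (\<exists>Y \<in> carrier_mat n m. \<exists>X \<in> carrier_mat m n.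
       x = four_block_mat (0\<^sub>m n n) Y X (0\<^sub>m m m))"
proof
  assume x: "x \<in> g1 n m"
  then have c: "x \<in> carrier_mat (n + m) (n + m)" and s: "sigma n m x = - x"
    by (auto simp: g1_def)
  have z: "x $$ (i, j) = 0" if "i < n + m" "j < n + m" "(i < n) = (j < n)" for i j
    using sigma_index[OF c that(1,2)] that s c by auto
  let ?Y = "mat n m (\<lambda>(i, j). x $$ (i, j + n))" and ?X = "mat m n (\<lambda>(i, j). x $$ (i + n, j))"
  have "x = four_block_mat (0\<^sub>m n n) ?Y ?X (0\<^sub>m m m)"
    by (rule eq_matI) (use c z in \<open>auto simp: four_block_mat_def Let_def\<close>)
  then show "\<exists>Y \<in> carrier_mat n m. \<exists>X \<in> carrier_mat m n.
       x = four_block_mat (0\<^sub>m n n) Y X (0\<^sub>m m m)"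
    by (meson mat_carrier)
next
  assume "\<exists>Y \<in> carrier_mat n m. \<exists>X \<in> carrier_mat m n.
       x = four_block_mat (0\<^sub>m n n) Y X (0\<^sub>m m m)"
  then obtain Y X where YX: "Y \<in> carrier_mat n m" "X \<in> carrier_mat m n"
    and x: "x = four_block_mat (0\<^sub>m n n) Y X (0\<^sub>m m m)" by blast
  have c: "x \<in> carrier_mat (n + m) (n + m)"
    unfolding x using four_block_carrier_mat[of "0\<^sub>m n n" n n "0\<^sub>m m m" m m] by simp
  have "sigma n m x = - x"
  proof (rule eq_matI)
    fix i j
    assume "i < dim_row (- x)" "j < dim_col (- x)"
    then have ij: "i < n + m" "j < n + m" using c by auto
    show "sigma n m x $$ (i, j) = (- x) $$ (i, j)"
      unfolding sigma_index[OF c ij] using c ij YX by (auto simp: x)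
  qed (use c sigma_carrier[OF c] in auto)
  then show "x \<in> g1 n m" using c by (simp add: g1_def)
qed

definition lie_bracket :: "'a::ring mat \<Rightarrow> 'a mat \<Rightarrow> 'a mat" where
  "lie_bracket x y = x * y - y * x"

definition commuting_variety :: "nat \<Rightarrow> nat \<Rightarrow> ('a::comm_ring_1 mat \<times> 'a mat) set" where
  "commuting_variety n m =
     {(x, y) \<in> g1 n m \<times> g1 n m. lie_bracket x y = 0\<^sub>m (n + m) (n + m)}"

definition commuting_variety_topology :: "nat \<Rightarrow> nat \<Rightarrow> ('a::idom mat \<times> 'a mat) topology" where
  "commuting_variety_topology n m =
     subtopology (zariski_mat_pairs (n + m)) (commuting_variety n m)"

end

theory Submission
  imports Defs "Jordan_Normal_Form.Determinant"
begin

text \<open>Write a pair in \<open>g1 n m \<times> g1 n m\<close> as two matrices with lower left blocks \<open>X\<^sub>1, X\<^sub>2\<close>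
  and upper right blocks \<open>Y\<^sub>1, Y\<^sub>2\<close>. The lower right block of the commutation relation says
  \<open>X\<^sub>1 Y\<^sub>2 = X\<^sub>2 Y\<^sub>1\<close>. With \<open>A\<close> the \<open>m \<times> 2n\<close> matrix \<open>(X\<^sub>1 X\<^sub>2)\<close> and \<open>B\<close> the \<open>2n \<times> m\<close> matrix
  that stacks \<open>Y\<^sub>2\<close> on \<open>- Y\<^sub>1\<close>, this is \<open>A B = 0\<close>, and hence \<open>rank A + rank B \<le> 2n\<close>.

  Rank is lower semicontinuous, so the pairs with \<open>rank A \<ge> s\<close> and \<open>rank B \<ge> 2n - s\<close> form an
  open set, and the rank inequality makes these open sets pairwise disjoint for different \<open>s\<close>.
  Both ranks are at most \<open>M = min (2n) m\<close>, which restricts \<open>s\<close> to \<open>2n - M \<le> s \<le> M\<close>;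
  for each of these \<open>2M - 2n + 1\<close> values a pair of partial permutation matrices
  (\<open>witness\<close>) shows that the set is nonempty.

  Disjoint nonempty open sets force distinct irreducible components: each of the sets meets
  some component, and two nonempty open subsets of an irreducible set intersect
  (\<open>irreducible_components_of_disjoint_opens\<close>). No dimension count is involved.

  To keep openness visible, the rank conditions are replaced by the nonvanishing of one
  \<open>s \<times> s\<close> minor of \<open>A\<close> and one \<open>(2n - s) \<times> (2n - s)\<close> minor of \<open>B\<close>, and the rank inequality by its
  form for invertible minors (\<open>invertible_minors_of_zero_product\<close>).\<close>

section \<open>Irreducible components and disjoint open sets\<close>

lemma irreducible_in_cover:
  assumes "irreducible_in X S" "closedin X A" "closedin X B" "S \<subseteq> A \<union> B"
  shows "S \<subseteq> A \<or> S \<subseteq> B"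
  using assms by (simp add: irreducible_in_def)

lemma irreducible_in_singleton:
  assumes "p \<in> topspace X"
  shows "irreducible_in X {p}"
  using assms by (simp add: irreducible_in_def)

text \<open>If the union escaped from both closed sets of a cover, a single member of the chain
  that is large enough would escape from both.\<close>

lemma irreducible_in_Union_chain:
  assumes "\<K> \<noteq> {}" and chain: "subset.chain {S. irreducible_in X S} \<K>"
  shows "irreducible_in X (\<Union>\<K>)"
proof -
  have irr: "irreducible_in X S" if "S \<in> \<K>" for S
    using chain that by (auto simp: subset.chain_def)
  have total: "S \<subseteq> T \<or> T \<subseteq> S" if "S \<in> \<K>" "T \<in> \<K>" for S T
    using chain that by (auto simp: subset.chain_def)
  have cover: "\<Union>\<K> \<subseteq> A \<or> \<Union>\<K> \<subseteq> B"
    if cl: "closedin X A" "closedin X B" and sub: "\<Union>\<K> \<subseteq> A \<union> B" for A B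
  proof (rule ccontr)
    assume "\<not> ?thesis"
    then obtain S T where S: "S \<in> \<K>" "\<not> S \<subseteq> A" and T: "T \<in> \<K>" "\<not> T \<subseteq> B"
      by (meson Sup_least)
    obtain R where R: "R \<in> \<K>" "S \<subseteq> R" "T \<subseteq> R"
      using total[OF S(1) T(1)] S(1) T(1) by auto
    have "R \<subseteq> A \<or> R \<subseteq> B"
      using irreducible_in_cover[OF irr[OF R(1)] cl] sub R(1) by (meson Sup_upper subset_trans)
    then show False using S(2) T(2) R(2,3) by (meson subset_trans)
  qed
  have "\<Union>\<K> \<subseteq> topspace X"
    using irr by (auto simp: irreducible_in_def)
  moreover obtain S where "S \<in> \<K>" using \<open>\<K> \<noteq> {}\<close> by auto
  then have "\<Union>\<K> \<noteq> {}"
    using irr[OF \<open>S \<in> \<K>\<close>] by (auto simp: irreducible_in_def)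
  ultimately show ?thesis
    using cover by (simp add: irreducible_in_def)
qed

lemma exists_irreducible_component:
  assumes "p \<in> topspace X"
  shows "\<exists>C \<in> irreducible_components X. p \<in> C"
proof -
  let ?A = "{S. irreducible_in X S \<and> p \<in> S}"
  have "\<exists>M\<in>?A. \<forall>S\<in>?A. M \<subseteq> S \<longrightarrow> S = M"
  proof (rule subset_Zorn_nonempty)
    have "{p} \<in> ?A" using irreducible_in_singleton[OF assms] by simp
    then show "?A \<noteq> {}" by auto
    fix \<K> assume K: "\<K> \<noteq> {}" "subset.chain ?A \<K>"
    have "subset.chain {S. irreducible_in X S} \<K>" and p: "\<forall>S\<in>\<K>. p \<in> S"
      using K(2) by (auto simp: subset.chain_def)
    then have "irreducible_in X (\<Union>\<K>)" using irreducible_in_Union_chain[OF K(1)] by simp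
    moreover have "p \<in> \<Union>\<K>" using p K(1) by auto
    ultimately show "\<Union>\<K> \<in> ?A" by simp
  qed
  then obtain M where M: "irreducible_in X M" "p \<in> M"
    and max: "\<And>S. irreducible_in X S \<Longrightarrow> p \<in> S \<Longrightarrow> M \<subseteq> S \<Longrightarrow> S = M"
    by auto
  have "M \<in> irreducible_components X"
    using M max by (simp add: irreducible_components_def subset_iff)
  then show ?thesis using M(2) by (rule rev_bexI)
qed

lemma irreducible_in_open_Int:
  assumes irr: "irreducible_in X C" and op: "openin X U" "openin X W"
    and meet: "C \<inter> U \<noteq> {}" "C \<inter> W \<noteq> {}"
  shows "U \<inter> W \<noteq> {}"
proof
  assume "U \<inter> W = {}"
  moreover have "C \<subseteq> topspace X" using irr by (simp add: irreducible_in_def)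
  ultimately have "C \<subseteq> (topspace X - U) \<union> (topspace X - W)" by auto
  then have "C \<subseteq> topspace X - U \<or> C \<subseteq> topspace X - W"
    by (rule irreducible_in_cover[OF irr closedin_diff[OF closedin_topspace op(1)]
          closedin_diff[OF closedin_topspace op(2)]])
  then show False using meet by auto
qed

text \<open>Choosing a component that meets each open set gives an injective choice, since a component
  meeting two of the sets would contradict their disjointness.\<close>

lemma irreducible_components_of_disjoint_opens:
  fixes U :: "'i \<Rightarrow> 'b set"
  assumes fin: "finite I"
    and op: "\<And>i. i \<in> I \<Longrightarrow> openin X (U i)"
    and ne: "\<And>i. i \<in> I \<Longrightarrow> U i \<noteq> {}"
    and disj: "\<And>i j. i \<in> I \<Longrightarrow> j \<in> I \<Longrightarrow> i \<noteq> j \<Longrightarrow> U i \<inter> U j = {}"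
  shows "\<exists>\<C> \<subseteq> irreducible_components X. finite \<C> \<and> card \<C> = card I"
proof -
  have "\<forall>i\<in>I. \<exists>C. C \<in> irreducible_components X \<and> C \<inter> U i \<noteq> {}"
  proof
    fix i assume i: "i \<in> I"
    obtain p where p: "p \<in> U i" using ne[OF i] by auto
    then have "p \<in> topspace X" using openin_subset[OF op[OF i]] by auto
    then obtain C where "C \<in> irreducible_components X" "p \<in> C"
      using exists_irreducible_component by metis
    with p show "\<exists>C. C \<in> irreducible_components X \<and> C \<inter> U i \<noteq> {}" by auto
  qed
  from bchoice[OF this] obtain C
    where C: "\<forall>i\<in>I. C i \<in> irreducible_components X \<and> C i \<inter> U i \<noteq> {}" ..
  have "inj_on C I"
  proof (rule inj_onI, rule ccontr)
    fix i j assume ij: "i \<in> I" "j \<in> I" and eq: "C i = C j" and "i \<noteq> j"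
    have "irreducible_in X (C i)" using C ij(1) by (simp add: irreducible_components_def)
    moreover have "C i \<inter> U i \<noteq> {}" "C i \<inter> U j \<noteq> {}" using C ij eq by auto
    ultimately have "U i \<inter> U j \<noteq> {}"
      by (rule irreducible_in_open_Int[OF _ op[OF ij(1)] op[OF ij(2)]])
    with disj[OF ij \<open>i \<noteq> j\<close>] show False by simp
  qed
  then have "card (C ` I) = card I" by (rule card_image)
  moreover have "C ` I \<subseteq> irreducible_components X" using C by auto
  ultimately show ?thesis using fin by (intro exI[of _ "C ` I"]) simp
qed


section \<open>Minors as polynomial functions\<close>

lemma poly_functions_sum:
  assumes "\<And>i. i \<in> I \<Longrightarrow> f i \<in> poly_functions coords"
  shows "(\<lambda>v. \<Sum>i\<in>I. f i v) \<in> poly_functions coords"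
  using assms
  by (induction I rule: infinite_finite_induct) (auto intro: poly_functions.const poly_functions.add)

lemma poly_functions_prod:
  assumes "\<And>i. i \<in> I \<Longrightarrow> f i \<in> poly_functions coords"
  shows "(\<lambda>v. \<Prod>i\<in>I. f i v) \<in> poly_functions coords"
  using assms
  by (induction I rule: infinite_finite_induct) (auto intro: poly_functions.const poly_functions.mult)

lemma poly_functions_uminus:
  assumes "f \<in> poly_functions coords"
  shows "(\<lambda>v. - f v) \<in> poly_functions coords"
  using poly_functions.mult[OF poly_functions.const[of "- 1"] assms] by simp

lemma poly_functions_det:
  assumes "\<And>i j. i < k \<Longrightarrow> j < k \<Longrightarrow> (\<lambda>v. f v i j) \<in> poly_functions coords"
  shows "(\<lambda>v. det (mat k k (\<lambda>(i, j). f v i j))) \<in> poly_functions coords"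
proof -
  have "(\<lambda>v. det (mat k k (\<lambda>(i, j). f v i j))) =
    (\<lambda>v. \<Sum>p | p permutes {0..<k}. signof p * (\<Prod>i = 0..<k. f v i (p i)))"
    by (intro ext, subst det_def'[of _ k])
      (auto intro!: sum.cong prod.cong arg_cong[where f = "(*) _"] simp: permutes_in_image)
  also have "\<dots> \<in> poly_functions coords"
    by (intro poly_functions_sum poly_functions.mult poly_functions.const poly_functions_prod assms)
      (auto simp: permutes_in_image)
  finally show ?thesis .
qed

lemma openin_commuting_variety_nonvanishing:
  assumes "f \<in> poly_functions (pair_entries (n + m))"
  shows "openin (commuting_variety_topology n m) {p \<in> commuting_variety n m. f p \<noteq> 0}"
proof -
  let ?V = "carrier_mat (n + m) (n + m) \<times> carrier_mat (n + m) (n + m)"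
  have "openin (zariski_mat_pairs (n + m)) (?V - zero_locus ?V {f})"
    unfolding zariski_mat_pairs_def openin_zariski using assms by blast
  moreover have "{p \<in> commuting_variety n m. f p \<noteq> 0} =
      (?V - zero_locus ?V {f}) \<inter> commuting_variety n m"
    by (auto simp: zero_locus_def commuting_variety_def g1_def)
  ultimately show ?thesis
    unfolding commuting_variety_topology_def openin_subtopology by blast
qed


section \<open>Invertible minors of two matrices with product zero\<close>

text \<open>The product does not change when \<open>C\<close> and \<open>D\<close> are padded by zeros to square matrices,
  and then the second factor has a zero row.\<close>

lemma det_mult_narrow_eq_0:
  fixes C D :: "'a::comm_ring_1 mat"
  assumes C: "C \<in> carrier_mat k q" and D: "D \<in> carrier_mat q k" and "q < k"
  shows "det (C * D) = 0"
proof -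
  let ?C = "mat k k (\<lambda>(i, l). if l < q then C $$ (i, l) else 0)"
  let ?D = "mat k k (\<lambda>(l, j). if l < q then D $$ (l, j) else 0)"
  have "C * D = ?C * ?D"
  proof (rule eq_matI)
    fix i j assume "i < dim_row (?C * ?D)" "j < dim_col (?C * ?D)"
    then have ij: "i < k" "j < k" by auto
    have "(\<Sum>l = 0..<q. C $$ (i, l) * D $$ (l, j)) =
        (\<Sum>l = 0..<k. (if l < q then C $$ (i, l) else 0) * (if l < q then D $$ (l, j) else 0))"
      using \<open>q < k\<close> by (intro sum.mono_neutral_cong_left) auto
    then show "(C * D) $$ (i, j) = (?C * ?D) $$ (i, j)"
      using ij C D by (simp add: scalar_prod_def)
  qed (use C D in auto)
  moreover have "det ?D = 0"
  proof (subst det_def'[of _ k], simp, rule sum.neutral, rule ballI)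
    fix p assume "p \<in> {p. p permutes {0..<k}}"
    then have "p q < k" using \<open>q < k\<close> permutes_in_image[of p "{0..<k}" q] by auto
    \<comment> \<open>Row \<open>q\<close> is the first padded row of \<open>?D\<close>; every term of the Leibniz formula uses it.\<close>
    then have "?D $$ (q, p q) = 0" using \<open>q < k\<close> by simp
    then have "(\<Prod>i = 0..<k. ?D $$ (i, p i)) = 0"
      using \<open>q < k\<close> by (intro prod_zero bexI[of _ q]) auto
    then show "signof p * (\<Prod>i = 0..<k. ?D $$ (i, p i)) = 0" by simp
  qed
  ultimately show ?thesis
    by (simp add: det_mult[of ?C k ?D])
qed

text \<open>The inequality between ranks of two matrices with product zero. Stack the chosen rows of
  \<open>A\<close> on the unit rows that select the chosen rows of \<open>B\<close>; put the unit columns that select the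
  chosen columns of \<open>A\<close> beside the chosen columns of \<open>B\<close>. The product of these two matrices is
  block triangular because \<open>A B = 0\<close>, with the two minors on its diagonal, so it is invertible;
  but it factors through dimension \<open>q\<close>.\<close>

lemma invertible_minors_of_zero_product:
  fixes A B :: "'a::idom mat"
  assumes A: "A \<in> carrier_mat p q" and B: "B \<in> carrier_mat q r" and AB: "A * B = 0\<^sub>m p r"
    and f: "\<And>i. i < s \<Longrightarrow> f i < p" and g: "\<And>i. i < s \<Longrightarrow> g i < q"
    and h: "\<And>i. i < t \<Longrightarrow> h i < q" and k: "\<And>i. i < t \<Longrightarrow> k i < r"
    and minor_A: "det (mat s s (\<lambda>(i, j). A $$ (f i, g j))) \<noteq> 0"
    and minor_B: "det (mat t t (\<lambda>(i, j). B $$ (h i, k j))) \<noteq> 0"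
  shows "s + t \<le> q"
proof (rule ccontr)
  assume "\<not> s + t \<le> q"
  let ?A = "mat s s (\<lambda>(i, j). A $$ (f i, g j))" and ?B = "mat t t (\<lambda>(i, j). B $$ (h i, k j))"
  let ?C = "mat (s + t) q (\<lambda>(i, l). if i < s then A $$ (f i, l) else if l = h (i - s) then 1 else 0)"
  let ?D = "mat q (s + t) (\<lambda>(l, j). if j < s then if l = g j then 1 else 0 else B $$ (l, k (j - s)))"
  let ?E = "mat t s (\<lambda>(i, j). if h i = g j then 1 else 0 :: 'a)"
  have AB0: "(\<Sum>l = 0..<q. A $$ (i, l) * B $$ (l, j)) = 0" if "i < p" "j < r" for i j
  proof -
    have "(A * B) $$ (i, j) = (\<Sum>l = 0..<q. A $$ (i, l) * B $$ (l, j))"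
      using A B that by (simp add: scalar_prod_def)
    then show ?thesis using AB that by simp
  qed
  have "?C * ?D = four_block_mat ?A (0\<^sub>m s t) ?E ?B"
  proof (rule eq_matI)
    fix i j assume "i < dim_row (four_block_mat ?A (0\<^sub>m s t) ?E ?B)"
      "j < dim_col (four_block_mat ?A (0\<^sub>m s t) ?E ?B)"
    then have ij: "i < s + t" "j < s + t" by auto
    have "(?C * ?D) $$ (i, j) = (\<Sum>l = 0..<q. ?C $$ (i, l) * ?D $$ (l, j))"
      using ij by (simp add: scalar_prod_def)
    also have "\<dots> = four_block_mat ?A (0\<^sub>m s t) ?E ?B $$ (i, j)"
    proof (cases "i < s"; cases "j < s")
      assume "i < s" "j < s"
      then show ?thesis using ij g by (simp add: if_distrib[of "\<lambda>u. c * u" for c] cong: if_cong)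
    next
      assume "i < s" "\<not> j < s"
      then show ?thesis using ij AB0[OF f k, of i "j - s"] by simp
    next
      assume "\<not> i < s" "j < s"
      then show ?thesis using ij h[of "i - s"] by (simp add: if_distrib[of "\<lambda>u. u * c" for c] cong: if_cong)
    next
      assume "\<not> i < s" "\<not> j < s"
      then show ?thesis using ij h[of "i - s"] by (simp add: if_distrib[of "\<lambda>u. u * c" for c] cong: if_cong)
    qed
    finally show "(?C * ?D) $$ (i, j) = four_block_mat ?A (0\<^sub>m s t) ?E ?B $$ (i, j)" .
  qed auto
  then have "det (?C * ?D) = det (four_block_mat ?A (0\<^sub>m s t) ?E ?B)"
    by (rule arg_cong)
  also have "\<dots> = det ?A * det ?B"
    by (rule det_four_block_mat_upper_right_zero) (rule mat_carrier refl)+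
  finally have "det (?C * ?D) = det ?A * det ?B" .
  moreover have "det (?C * ?D) = 0"
    using \<open>\<not> s + t \<le> q\<close> by (intro det_mult_narrow_eq_0[of _ "s + t" q] mat_carrier) linarith
  ultimately have "det ?A * det ?B = 0" by (rule trans[OF sym])
  with minor_A minor_B show False by (metis mult_eq_0_iff)
qed


section \<open>The two block matrices of a commuting pair\<close>

text \<open>The matrices \<open>A\<close> and \<open>B\<close> of the introduction. The sign in \<open>B\<close> turns a block of the
  commutation relation into a product equal to zero.\<close>

definition lower_blocks :: "nat \<Rightarrow> nat \<Rightarrow> 'a::comm_ring_1 mat \<times> 'a mat \<Rightarrow> 'a mat" where
  "lower_blocks n m = (\<lambda>(x, y). mat m (2 * n)
     (\<lambda>(i, l). if l < n then x $$ (n + i, l) else y $$ (n + i, l - n)))"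

definition upper_blocks :: "nat \<Rightarrow> nat \<Rightarrow> 'a::comm_ring_1 mat \<times> 'a mat \<Rightarrow> 'a mat" where
  "upper_blocks n m = (\<lambda>(x, y). mat (2 * n) m
     (\<lambda>(l, j). if l < n then y $$ (l, n + j) else - x $$ (l - n, n + j)))"

lemma lower_blocks_carrier: "lower_blocks n m p \<in> carrier_mat m (2 * n)"
  by (auto simp: lower_blocks_def split: prod.splits)

lemma upper_blocks_carrier: "upper_blocks n m p \<in> carrier_mat (2 * n) m"
  by (auto simp: upper_blocks_def split: prod.splits)

lemma g1_iff:
  fixes x :: "'a::{idom, ring_char_0} mat"
  shows "x \<in> g1 n m \<longleftrightarrow> x \<in> carrier_mat (n + m) (n + m) \<and>
    (\<forall>i < n + m. \<forall>j < n + m. (i < n) = (j < n) \<longrightarrow> x $$ (i, j) = 0)"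
proof
  assume "x \<in> g1 n m"
  then show "x \<in> carrier_mat (n + m) (n + m) \<and>
    (\<forall>i < n + m. \<forall>j < n + m. (i < n) = (j < n) \<longrightarrow> x $$ (i, j) = 0)"
    by (auto simp: g1_block)
next
  assume x: "x \<in> carrier_mat (n + m) (n + m) \<and>
    (\<forall>i < n + m. \<forall>j < n + m. (i < n) = (j < n) \<longrightarrow> x $$ (i, j) = 0)"
  have "sigma n m x = - x"
    by (rule eq_matI) (use x sigma_carrier[of x n m] in \<open>auto simp: sigma_index\<close>)
  then show "x \<in> g1 n m" using x by (simp add: g1_def)
qed

lemma carrier_g1: "x \<in> g1 n m \<Longrightarrow> x \<in> carrier_mat (n + m) (n + m)"
  by (simp add: g1_def)

lemma lower_upper_blocks_zero:
  fixes p :: "'a::{idom, ring_char_0} mat \<times> 'a mat"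
  assumes "p \<in> commuting_variety n m"
  shows "lower_blocks n m p * upper_blocks n m p = 0\<^sub>m m m"
proof -
  obtain x y where p: "p = (x, y)" by fastforce
  have x: "x \<in> g1 n m" and y: "y \<in> g1 n m" and comm: "x * y - y * x = 0\<^sub>m (n + m) (n + m)"
    using assms by (auto simp: p commuting_variety_def lie_bracket_def)
  note xc = carrier_g1[OF x] and yc = carrier_g1[OF y]
  have prod: "(u * v) $$ (n + i, n + j) = (\<Sum>l = 0..<n. u $$ (n + i, l) * v $$ (l, n + j))"
    if u: "u \<in> g1 n m" and v: "v \<in> g1 n m" and ij: "i < m" "j < m" for u v :: "'a mat" and i j
  proof -
    have "(u * v) $$ (n + i, n + j) = (\<Sum>l = 0..<n + m. u $$ (n + i, l) * v $$ (l, n + j))"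
      using carrier_g1[OF u] carrier_g1[OF v] ij by (simp add: scalar_prod_def)
    also have "\<dots> = (\<Sum>l = 0..<n. u $$ (n + i, l) * v $$ (l, n + j))"
      using u ij by (intro sum.mono_neutral_right) (auto simp: g1_iff)
    finally show ?thesis .
  qed
  show ?thesis
  proof (rule eq_matI)
    fix i j assume "i < dim_row (0\<^sub>m m m :: 'a mat)" "j < dim_col (0\<^sub>m m m :: 'a mat)"
    then have ij: "i < m" "j < m" by auto
    have "(lower_blocks n m p * upper_blocks n m p) $$ (i, j) =
      (\<Sum>l = 0..<n + n. lower_blocks n m p $$ (i, l) * upper_blocks n m p $$ (l, j))"
      using ij lower_blocks_carrier[of n m p] upper_blocks_carrier[of n m p]
      by (simp add: scalar_prod_def mult_2)
    also have "\<dots> =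
      (\<Sum>l = 0..<n. lower_blocks n m p $$ (i, l) * upper_blocks n m p $$ (l, j)) +
      (\<Sum>l = 0..<n. lower_blocks n m p $$ (i, n + l) * upper_blocks n m p $$ (n + l, j))"
      using sum.atLeastLessThan_concat[of 0 n "n + n"
          "\<lambda>l. lower_blocks n m p $$ (i, l) * upper_blocks n m p $$ (l, j)"]
        sum.shift_bounds_nat_ivl[of "\<lambda>l. lower_blocks n m p $$ (i, l) * upper_blocks n m p $$ (l, j)" 0 n n]
      by (simp add: add.commute)
    also have "\<dots> = (\<Sum>l = 0..<n. x $$ (n + i, l) * y $$ (l, n + j))
        + (\<Sum>l = 0..<n. - (y $$ (n + i, l) * x $$ (l, n + j)))"
      using ij by (intro arg_cong2[where f = "(+)"] sum.cong)
        (auto simp: p lower_blocks_def upper_blocks_def)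
    also have "\<dots> = (x * y - y * x) $$ (n + i, n + j)"
      using ij xc yc by (simp add: prod[OF x y] prod[OF y x] sum_negf del: index_mult_mat(1))
    also have "\<dots> = 0" using ij unfolding comm by simp
    finally show "(lower_blocks n m p * upper_blocks n m p) $$ (i, j) = 0\<^sub>m m m $$ (i, j)"
      using ij by simp
  qed (use lower_blocks_carrier[of n m p] upper_blocks_carrier[of n m p] in auto)
qed


section \<open>Separating functions\<close>

text \<open>The minor of \<open>A\<close> takes its first \<open>s\<close> rows and columns; the minor of \<open>B\<close> takes the complementary
  rows \<open>s, \<dots>, 2n - 1\<close>. When \<open>2n > m\<close> the columns of \<open>B\<close> with these same indices need not exist,
  so they are reduced modulo \<open>m\<close>.\<close>

definition lower_minor :: "nat \<Rightarrow> nat \<Rightarrow> nat \<Rightarrow> 'a::comm_ring_1 mat \<times> 'a mat \<Rightarrow> 'a" where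
  "lower_minor n m s p = det (mat s s (\<lambda>(i, j). lower_blocks n m p $$ (i, j)))"

definition upper_minor :: "nat \<Rightarrow> nat \<Rightarrow> nat \<Rightarrow> 'a::comm_ring_1 mat \<times> 'a mat \<Rightarrow> 'a" where
  "upper_minor n m s p = det (mat (2 * n - s) (2 * n - s)
     (\<lambda>(i, j). upper_blocks n m p $$ (s + i, (s + j) mod m)))"

lemma coordinate_functions:
  assumes "i < N" "j < N"
  shows "(\<lambda>p. fst p $$ (i, j)) \<in> poly_functions (pair_entries N)"
    and "(\<lambda>p. snd p $$ (i, j)) \<in> poly_functions (pair_entries N)"
proof -
  have "(\<lambda>p. fst p $$ (i, j)) = (\<lambda>(x, y). x $$ (i, j))"
    "(\<lambda>p. snd p $$ (i, j)) = (\<lambda>(x, y). y $$ (i, j))" by auto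
  then have "(\<lambda>p. fst p $$ (i, j)) \<in> pair_entries N" "(\<lambda>p. snd p $$ (i, j)) \<in> pair_entries N"
    using assms unfolding pair_entries_def by blast+
  then show "(\<lambda>p. fst p $$ (i, j)) \<in> poly_functions (pair_entries N)"
    "(\<lambda>p. snd p $$ (i, j)) \<in> poly_functions (pair_entries N)"
    by (auto intro: poly_functions.coord)
qed

lemma poly_functions_lower_minor:
  assumes "s \<le> m" "s \<le> 2 * n"
  shows "lower_minor n m s \<in> poly_functions (pair_entries (n + m))"
  unfolding lower_minor_def[abs_def]
proof (rule poly_functions_det)
  fix i j assume ij: "i < s" "j < s"
  have "(\<lambda>p. lower_blocks n m p $$ (i, j)) =
      (if j < n then (\<lambda>p. fst p $$ (n + i, j)) else (\<lambda>p. snd p $$ (n + i, j - n)))"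
    using ij assms by (auto simp: lower_blocks_def fun_eq_iff)
  also have "\<dots> \<in> poly_functions (pair_entries (n + m))"
    using ij assms by (auto intro!: coordinate_functions)
  finally show "(\<lambda>p. lower_blocks n m p $$ (i, j)) \<in> poly_functions (pair_entries (n + m))" .
qed

lemma poly_functions_upper_minor:
  assumes "0 < m" "s \<le> 2 * n"
  shows "upper_minor n m s \<in> poly_functions (pair_entries (n + m))"
  unfolding upper_minor_def[abs_def]
proof (rule poly_functions_det)
  fix i j assume ij: "i < 2 * n - s" "j < 2 * n - s"
  have r: "(s + j) mod m < m" using \<open>0 < m\<close> by simp
  have "(\<lambda>p. upper_blocks n m p $$ (s + i, (s + j) mod m)) =
      (if s + i < n then (\<lambda>p. snd p $$ (s + i, n + (s + j) mod m))
       else (\<lambda>p. - fst p $$ (s + i - n, n + (s + j) mod m)))"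
    using ij assms r by (auto simp: upper_blocks_def fun_eq_iff)
  also have "\<dots> \<in> poly_functions (pair_entries (n + m))"
    using ij r by (auto intro!: coordinate_functions poly_functions_uminus)
  finally show "(\<lambda>p. upper_blocks n m p $$ (s + i, (s + j) mod m))
      \<in> poly_functions (pair_entries (n + m))" .
qed

lemma upper_minor_eq_0_if_larger_lower_minor:
  fixes p :: "'a::{idom, ring_char_0} mat \<times> 'a mat"
  assumes p: "p \<in> commuting_variety n m" and "0 < m"
    and t: "t \<le> m" "t \<le> 2 * n" and "s < t"
    and nz: "lower_minor n m t p \<noteq> 0"
  shows "upper_minor n m s p = 0"
proof (rule ccontr)
  assume "upper_minor n m s p \<noteq> 0"
  then have "t + (2 * n - s) \<le> 2 * n"
    using invertible_minors_of_zero_product[OF lower_blocks_carrier upper_blocks_carrier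
        lower_upper_blocks_zero[OF p], of t id id "2 * n - s" "\<lambda>i. s + i" "\<lambda>j. (s + j) mod m"]
      nz t \<open>0 < m\<close>
    by (auto simp: lower_minor_def upper_minor_def)
  then show False using \<open>s < t\<close> t by simp
qed


section \<open>Commuting pairs of partial permutation matrices\<close>

text \<open>The pair with \<open>A\<close> having entry \<open>1\<close> at \<open>(c mod m, c)\<close> for \<open>c < s\<close>, \<open>B\<close> having entry \<open>1\<close> at
  \<open>(c, c mod m)\<close> for \<open>s \<le> c < 2n\<close>, and zeros elsewhere. Since the two ranges of \<open>c\<close> are disjoint,
  \<open>A B = 0\<close>. The other block of the commutation relation also holds: both \<open>Y\<^sub>1 X\<^sub>2\<close> and \<open>Y\<^sub>2 X\<^sub>1\<close>
  vanish, as \<open>c mod m\<close> is injective on \<open>{0..<n}\<close> and on \<open>{n..<2n}\<close> when \<open>n \<le> m\<close>.\<close>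

definition witness :: "nat \<Rightarrow> nat \<Rightarrow> nat \<Rightarrow> 'a::comm_ring_1 mat \<times> 'a mat" where
  "witness n m s =
    (mat (n + m) (n + m) (\<lambda>(i, j).
       if n \<le> i \<and> j < n \<and> j < s \<and> i - n = j mod m then 1
       else if i < n \<and> n \<le> j \<and> s \<le> n + i \<and> j - n = (n + i) mod m then - 1 else 0),
     mat (n + m) (n + m) (\<lambda>(i, j).
       if n \<le> i \<and> j < n \<and> n + j < s \<and> i - n = (n + j) mod m then 1
       else if i < n \<and> n \<le> j \<and> s \<le> i \<and> j - n = i mod m then 1 else 0))"

lemma mod_eq_imp_eq_nat:
  fixes a b m :: nat
  assumes "a mod m = b mod m" "a < b + m" "b < a + m"
  shows "a = b"
proof (rule ccontr)
  assume "a \<noteq> b"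
  consider "a \<le> b" | "b \<le> a" by linarith
  then show False
  proof cases
    case 1
    then have "m dvd b - a" using assms(1) by (metis mod_eq_dvd_iff_nat)
    with \<open>a \<noteq> b\<close> 1 assms(3) show False by (auto dest: dvd_imp_le)
  next
    case 2
    then have "m dvd a - b" using assms(1) by (metis mod_eq_dvd_iff_nat)
    with \<open>a \<noteq> b\<close> 2 assms(2) show False by (auto dest: dvd_imp_le)
  qed
qed

text \<open>Each summand of each entry of \<open>x y\<close> and \<open>y x\<close> is zero: a nonzero one would need two indices
  \<open>c < s \<le> c'\<close> in the same half of \<open>{0..<2n}\<close> that are congruent modulo \<open>m\<close>.\<close>

lemma witness_in_commuting_variety:
  assumes "n \<le> m"
  shows "(witness n m s :: 'a::{idom, ring_char_0} mat \<times> 'a mat) \<in> commuting_variety n m"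
proof -
  obtain x y where w: "(witness n m s :: 'a mat \<times> 'a mat) = (x, y)" by fastforce
  have x: "x \<in> g1 n m" and y: "y \<in> g1 n m"
    using w by (auto simp: g1_iff witness_def)
  have c: "x \<in> carrier_mat (n + m) (n + m)" "y \<in> carrier_mat (n + m) (n + m)"
    using w by (auto simp: witness_def)
  have xy: "x $$ (i, l) * y $$ (l, j) = 0" if "i < n + m" "l < n + m" "j < n + m" for i j l
    using w that
    by (auto simp: witness_def split: if_splits)
      (drule mod_eq_imp_eq_nat; use \<open>n \<le> m\<close> in linarith)+
  have yx: "y $$ (i, l) * x $$ (l, j) = 0" if "i < n + m" "l < n + m" "j < n + m" for i j l
    using w that
    by (auto simp: witness_def split: if_splits)
      (drule mod_eq_imp_eq_nat; use \<open>n \<le> m\<close> in linarith)+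
  have "x * y = 0\<^sub>m (n + m) (n + m)"
    by (rule eq_matI) (use c in \<open>auto simp: scalar_prod_def xy intro!: sum.neutral\<close>)
  moreover have "y * x = 0\<^sub>m (n + m) (n + m)"
    by (rule eq_matI) (use c in \<open>auto simp: scalar_prod_def yx intro!: sum.neutral\<close>)
  ultimately have "lie_bracket x y = 0\<^sub>m (n + m) (n + m)"
    by (simp add: lie_bracket_def)
  then show ?thesis using x y by (simp add: w commuting_variety_def)
qed

lemma lower_minor_witness:
  assumes "s \<le> m" "s \<le> 2 * n"
  shows "lower_minor n m s (witness n m s) = (1 :: 'a::comm_ring_1)"
proof -
  let ?w = "witness n m s :: 'a mat \<times> 'a mat"
  have "mat s s (\<lambda>(i, j). lower_blocks n m ?w $$ (i, j)) = 1\<^sub>m s"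
    by (rule eq_matI) (use assms in \<open>auto simp: lower_blocks_def witness_def\<close>)
  from arg_cong[OF this, of det] show ?thesis by (simp only: lower_minor_def det_one)
qed

lemma upper_minor_witness:
  assumes "0 < m" "2 * n - s \<le> m"
  shows "upper_minor n m s (witness n m s) = (1 :: 'a::comm_ring_1)"
proof -
  let ?w = "witness n m s :: 'a mat \<times> 'a mat"
  have inj: "i = j" if "(s + i) mod m = (s + j) mod m" "i < 2 * n - s" "j < 2 * n - s" for i j
    using mod_eq_imp_eq_nat[OF that(1)] that assms by linarith
  have "upper_blocks n m ?w $$ (s + i, (s + j) mod m) = (if i = j then 1 else 0)"
    if "i < 2 * n - s" "j < 2 * n - s" for i j
  proof -
    have "upper_blocks n m ?w $$ (s + i, (s + j) mod m) =
        (if (s + j) mod m = (s + i) mod m then 1 else 0)"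
      using that \<open>0 < m\<close> by (simp add: upper_blocks_def witness_def)
    moreover have "(s + j) mod m = (s + i) mod m \<longleftrightarrow> i = j"
      using inj[of i j] that by metis
    ultimately show ?thesis by simp
  qed
  then have "mat (2 * n - s) (2 * n - s)
      (\<lambda>(i, j). upper_blocks n m ?w $$ (s + i, (s + j) mod m)) = 1\<^sub>m (2 * n - s)"
    by (intro eq_matI) auto
  from arg_cong[OF this, of det] show ?thesis by (simp only: upper_minor_def det_one)
qed

theorem proposition4p4:
  fixes n m :: nat
  assumes "0 < n" and "n \<le> m"
  shows "\<exists>\<C> \<subseteq> irreducible_components
            (commuting_variety_topology n m ::
              ('a::{alg_closed_field, field_char_0} mat \<times> 'a mat) topology).
           finite \<C> \<and> card \<C> = 2 * min (2 * n) m - 2 * n + 1"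
proof -
  \<comment> \<open>The interval lists the \<open>s\<close> for which both \<open>s\<close> and \<open>2n - s\<close> are possible ranks.\<close>
  let ?M = "min (2 * n) m"
  let ?I = "{2 * n - ?M..?M}"
  let ?f = "\<lambda>s (p :: 'a mat \<times> 'a mat). lower_minor n m s p * upper_minor n m s p"
  let ?U = "\<lambda>s. {p \<in> commuting_variety n m. ?f s p \<noteq> 0}"
  have m: "0 < m" using assms by simp
  have "\<exists>\<C> \<subseteq> irreducible_components (commuting_variety_topology n m :: ('a mat \<times> 'a mat) topology).
      finite \<C> \<and> card \<C> = card ?I"
  proof (rule irreducible_components_of_disjoint_opens[where U = ?U])
    fix s assume "s \<in> ?I"
    then have s: "s \<le> m" "s \<le> 2 * n" "2 * n - s \<le> m" by auto
    show "openin (commuting_variety_topology n m) (?U s)"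
      by (intro openin_commuting_variety_nonvanishing poly_functions.mult
          poly_functions_lower_minor poly_functions_upper_minor s m)
    have "witness n m s \<in> ?U s"
      using s m assms by (simp add: witness_in_commuting_variety lower_minor_witness upper_minor_witness)
    then show "?U s \<noteq> {}" by blast
  next
    fix s t assume st: "s \<in> ?I" "t \<in> ?I" "s \<noteq> t"
    have "\<not> (p \<in> ?U s \<and> p \<in> ?U t)" for p
      using upper_minor_eq_0_if_larger_lower_minor[of p n m t s] upper_minor_eq_0_if_larger_lower_minor[of p n m s t] m st
      by (cases "s < t") auto
    then show "?U s \<inter> ?U t = {}" by blast
  qed simp
  moreover have "card ?I = 2 * ?M - 2 * n + 1"
    using assms by simp
  ultimately show ?thesis by simp
qed

end
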